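(* Let $S_\ell$ denote the static quantization sensitivity of layer $\ell$ and $u_\ell(\boldsymbol{\phi})=\Pr_{x\sim\mathcal{D}}(K_{\boldsymbol{\phi}}(x)\ge\ell)$ its utilization probability under the exit policy $\boldsymbol{\phi}$, for $\ell=1,\dots,L$. Assume that static mixed-precision quantization (MPQ) ranks layers by their static sensitivities $S_\ell$, while amortized-precision quantization (APQ) ranks layers by their utilization-weighted sensitivities $u_\ell(\boldsymbol{\phi})S_\ell$. If there exist two layers $i$ and $j$ such that $$S_i>S_j\quad\text{but}\quad u_i(\boldsymbol{\phi})S_i<u_j(\boldsymbol{\phi})S_j,$$ then the static MPQ ranking is inconsistent with the APQ ranking. Moreover, under equal marginal bit-cost increments and marginal APQ benefit proportional to $u_\ell(\boldsymbol{\phi})S_\ell$, the static MPQ allocation can be suboptimal for the APQ objective.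
   Context: A network has $L$ layers with early exits. The exit policy is a vector of thresholds $\boldsymbol{\phi}=\{\phi_\ell\}_{\ell=1}^L$ with $\phi_\ell\in[0,1]$; the stopping depth $K_{\boldsymbol{\phi}}(x)$ of an input $x$ drawn from the data distribution $\mathcal{D}$ is the first layer $\ell$ whose exit confidence $\rho_\ell(x)$ (maximal softmax probability of the logits at layer $\ell$) satisfies $\rho_\ell(x)\ge\phi_\ell$, with value $L$ if there is none. Thus $u_\ell(\boldsymbol{\phi})$ is the probability that layer $\ell$ is reached. A bit allocation is a vector $\boldsymbol{b}=\{b_\ell\}_{\ell=1}^L$ assigning to each layer a bit-width from a given set. Static MPQ allocates bit-widths according to the static sensitivities $S_\ell$, implicitly assuming that every layer is executed for every input. Layers with larger ranking quantity are ranked higher. "Equal marginal bit-cost increments" means that an additional bit-width increment has the same budget cost for each of the layers compared; "marginal APQ benefit" of layer $\ell$ is the benefit for the APQ objective of assigning an additional bit-width increment to layer $\ell$. The APQ objective, to be minimized over $(\boldsymbol{b},\boldsymbol{\phi})$, is the expected task loss of the quantized early-exit network plus $\lambda\sum_{\ell=1}^L u_\ell(\boldsymbol{\phi})c_\ell(b_\ell)$, where $c_\ell(b_\ell)$ is the computational cost of layer $\ell$ at bit-width $b_\ell$ and $\lambda$ is a trade-off coefficient. *)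

theory Defs
  imports "HOL-Probability.Probability"
begin

text \<open>
  Layers are the numbers \<open>1, \<dots>, L\<close>.  The argument \<open>logits l x\<close> is the logit vector at the exit of
  layer \<open>l\<close>; it alone drives the exit decisions, so the stopping depth is a function of the policy
  and the input and does not depend on the bit allocation.
\<close>

definition softmax :: "real ^ 'c::finite \<Rightarrow> 'c \<Rightarrow> real"
  where "softmax z k = exp (z $ k) / (\<Sum>m\<in>UNIV. exp (z $ m))"

definition confidence :: "(nat \<Rightarrow> 'x \<Rightarrow> real ^ 'c::finite) \<Rightarrow> nat \<Rightarrow> 'x \<Rightarrow> real"
  where "confidence logits l x = Max (range (softmax (logits l x)))"

definition exit_policy :: "nat \<Rightarrow> (nat \<Rightarrow> real) \<Rightarrow> bool"
  where "exit_policy L \<phi> \<longleftrightarrow> (\<forall>l\<in>{1..L}. \<phi> l \<in> {0..1})"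

definition stopping_depth ::
    "nat \<Rightarrow> (nat \<Rightarrow> 'x \<Rightarrow> real ^ 'c::finite) \<Rightarrow> (nat \<Rightarrow> real) \<Rightarrow> 'x \<Rightarrow> nat"
  where "stopping_depth L logits \<phi> x =
    (if \<exists>l\<in>{1..L}. \<phi> l \<le> confidence logits l x
     then LEAST l. l \<in> {1..L} \<and> \<phi> l \<le> confidence logits l x
     else L)"

text \<open>
  The data distribution \<open>D\<close> is the joint law of an input and its label; the label only enters the
  task loss.
\<close>

definition early_exit_network ::
    "('x \<times> 'y) measure \<Rightarrow> nat \<Rightarrow> (nat \<Rightarrow> 'x \<Rightarrow> real ^ 'c::finite) \<Rightarrow> bool"
  where "early_exit_network D L logits \<longleftrightarrow>
    prob_space D \<and> (\<forall>l\<in>{1..L}. (\<lambda>(x, y). logits l x) \<in> borel_measurable D)"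

definition utilization ::
    "('x \<times> 'y) measure \<Rightarrow> nat \<Rightarrow> (nat \<Rightarrow> 'x \<Rightarrow> real ^ 'c::finite) \<Rightarrow> (nat \<Rightarrow> real) \<Rightarrow> nat \<Rightarrow> real"
  where "utilization D L logits \<phi> l = \<P>(z in D. l \<le> stopping_depth L logits \<phi> (fst z))"

text \<open>
  A ranking of the layers by the quantity \<open>s\<close> is a list of all layers, highest first; ties may be
  broken in any way.
\<close>

definition is_ranking :: "nat \<Rightarrow> (nat \<Rightarrow> real) \<Rightarrow> nat list \<Rightarrow> bool"
  where "is_ranking L s \<sigma> \<longleftrightarrow>
    distinct \<sigma> \<and> set \<sigma> = {1..L} \<and> sorted_wrt (\<lambda>k l. s k \<ge> s l) \<sigma>"

definition ranked_above :: "nat list \<Rightarrow> nat \<Rightarrow> nat \<Rightarrow> bool"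
  where "ranked_above \<sigma> k l \<longleftrightarrow> (\<exists>m n. m < n \<and> n < length \<sigma> \<and> \<sigma> ! m = k \<and> \<sigma> ! n = l)"

definition inconsistent_rankings :: "nat list \<Rightarrow> nat list \<Rightarrow> bool"
  where "inconsistent_rankings \<sigma> \<tau> \<longleftrightarrow> (\<exists>k l. ranked_above \<sigma> k l \<and> ranked_above \<tau> l k)"

text \<open>
  Bit allocations are functions from layers to the set \<open>W\<close> of available bit-widths.  The argument
  \<open>w l v\<close> is the amount of budget that layer \<open>l\<close> consumes at bit-width \<open>v\<close>.
\<close>

definition allocations :: "nat \<Rightarrow> nat set \<Rightarrow> (nat \<Rightarrow> nat) set"
  where "allocations L W = {1..L} \<rightarrow>\<^sub>E W"

definition bit_cost :: "nat \<Rightarrow> (nat \<Rightarrow> nat \<Rightarrow> real) \<Rightarrow> (nat \<Rightarrow> nat) \<Rightarrow> real"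
  where "bit_cost L w b = (\<Sum>l=1..L. w l (b l))"

definition feasible :: "nat \<Rightarrow> nat set \<Rightarrow> (nat \<Rightarrow> nat \<Rightarrow> real) \<Rightarrow> real \<Rightarrow> (nat \<Rightarrow> nat) set"
  where "feasible L W w B = {b \<in> allocations L W. bit_cost L w b \<le> B}"

definition next_width :: "nat set \<Rightarrow> nat \<Rightarrow> nat"
  where "next_width W v = (LEAST v'. v' \<in> W \<and> v < v')"

definition increment :: "nat set \<Rightarrow> nat set \<Rightarrow> (nat \<Rightarrow> nat) \<Rightarrow> nat \<Rightarrow> nat"
  where "increment W T b = (\<lambda>l. if l \<in> T then next_width W (b l) else b l)"

text \<open>
  Allocation by a ranking \<open>\<sigma>\<close>: starting from \<open>b\<close>, the layers are visited from the highest ranked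
  to the lowest ranked one, and each layer of \<open>C\<close> receives one bit-width increment whenever the
  budget \<open>B\<close> still allows it.
\<close>

definition ranked_allocation ::
    "nat \<Rightarrow> nat set \<Rightarrow> (nat \<Rightarrow> nat \<Rightarrow> real) \<Rightarrow> real \<Rightarrow> nat set \<Rightarrow> (nat \<Rightarrow> nat) \<Rightarrow> nat list \<Rightarrow> nat \<Rightarrow> nat"
  where "ranked_allocation L W w B C b \<sigma> =
    fold (\<lambda>l a. if l \<in> C \<and> bit_cost L w (increment W {l} a) \<le> B then increment W {l} a else a) \<sigma> b"

text \<open>
  The argument \<open>qlogits b l x\<close> is the logit vector at the exit of layer \<open>l\<close> of the network quantized
  according to \<open>b\<close>.
\<close>

definition sample_loss ::
    "nat \<Rightarrow> (nat \<Rightarrow> 'x \<Rightarrow> real ^ 'c::finite) \<Rightarrow> ((nat \<Rightarrow> nat) \<Rightarrow> nat \<Rightarrow> 'x \<Rightarrow> real ^ 'c) \<Rightarrow>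
     (real ^ 'c \<Rightarrow> 'y \<Rightarrow> real) \<Rightarrow> (nat \<Rightarrow> nat) \<Rightarrow> (nat \<Rightarrow> real) \<Rightarrow> 'x \<times> 'y \<Rightarrow> real"
  where "sample_loss L logits qlogits loss b \<phi> =
    (\<lambda>(x, y). loss (qlogits b (stopping_depth L logits \<phi> x) x) y)"

definition apq_objective ::
    "('x \<times> 'y) measure \<Rightarrow> nat \<Rightarrow> (nat \<Rightarrow> 'x \<Rightarrow> real ^ 'c::finite) \<Rightarrow>
     ((nat \<Rightarrow> nat) \<Rightarrow> nat \<Rightarrow> 'x \<Rightarrow> real ^ 'c) \<Rightarrow> (real ^ 'c \<Rightarrow> 'y \<Rightarrow> real) \<Rightarrow>
     (nat \<Rightarrow> nat \<Rightarrow> real) \<Rightarrow> real \<Rightarrow> (nat \<Rightarrow> nat) \<Rightarrow> (nat \<Rightarrow> real) \<Rightarrow> real"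
  where "apq_objective D L logits qlogits loss c lam b \<phi> =
    (\<integral>z. sample_loss L logits qlogits loss b \<phi> z \<partial>D)
    + lam * (\<Sum>l=1..L. utilization D L logits \<phi> l * c l (b l))"

text \<open>
  The competitor uses the same policy, so a suboptimal \<open>b\<close> is in particular not part of an optimal
  pair \<open>(b, \<phi>)\<close> for the joint minimization.
\<close>

definition suboptimal ::
    "((nat \<Rightarrow> nat) \<Rightarrow> (nat \<Rightarrow> real) \<Rightarrow> real) \<Rightarrow> (nat \<Rightarrow> nat) set \<Rightarrow> (nat \<Rightarrow> real) \<Rightarrow> (nat \<Rightarrow> nat) \<Rightarrow> bool"
  where "suboptimal J F \<phi> b \<longleftrightarrow> b \<in> F \<and> (\<exists>b'\<in>F. J b' \<phi> < J b \<phi>)"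

text \<open>
  Equal marginal bit-cost increments on the compared layers \<open>C\<close> at the allocation \<open>b\<close>.  Costs are
  positive: an increment that costs nothing is not restricted by any budget.
\<close>

definition equal_cost_increments ::
    "nat set \<Rightarrow> (nat \<Rightarrow> nat \<Rightarrow> real) \<Rightarrow> nat set \<Rightarrow> (nat \<Rightarrow> nat) \<Rightarrow> bool"
  where "equal_cost_increments W w C b \<longleftrightarrow>
    (\<exists>\<delta>>0. \<forall>l\<in>C. w l (next_width W (b l)) - w l (b l) = \<delta>)"

text \<open>
  Marginal benefit proportional to \<open>s\<close>.  The factor of proportionality is common to all compared
  layers still without an increment, but may depend on the set \<open>T\<close> of layers already incremented;
  benefits need not be additive over layers.
\<close>

definition proportional_benefit ::
    "((nat \<Rightarrow> nat) \<Rightarrow> (nat \<Rightarrow> real) \<Rightarrow> real) \<Rightarrow> (nat \<Rightarrow> real) \<Rightarrow> nat set \<Rightarrow> nat set \<Rightarrow> (nat \<Rightarrow> nat) \<Rightarrow>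
     (nat \<Rightarrow> real) \<Rightarrow> bool"
  where "proportional_benefit J \<phi> W C b s \<longleftrightarrow>
    (\<forall>T\<subseteq>C. \<exists>\<kappa>>0. \<forall>l\<in>C - T.
       J (increment W T b) \<phi> - J (increment W (insert l T) b) \<phi> = \<kappa> * s l)"

end

theory Submission
  imports Defs
begin

text \<open>
  Let \<open>M\<close> be the set of compared layers \<open>l\<close> with \<open>S l > S j\<close>; it contains \<open>i\<close> but not \<open>j\<close>.  Give
  the ranked allocation a budget for exactly \<open>card M\<close> increments.  However ties are broken, a static
  ranking lists \<open>M\<close> before the other compared layers, so it increments exactly \<open>M\<close>.  Exchanging \<open>i\<close>
  for \<open>j\<close> keeps the cost, and the two benefits on top of \<open>M - {i}\<close> share the same positive factor
  of proportionality, so the exchange strictly lowers the objective.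
\<close>

text \<open>The reverse order would contradict sortedness because the inequality between the scores
  is strict, so the tie-breaking has no influence.\<close>

lemma ranked_above_if_greater:
  assumes "is_ranking L s \<sigma>" and "k \<in> {1..L}" and "l \<in> {1..L}" and "s k > s l"
  shows "ranked_above \<sigma> k l"
proof -
  from assms obtain m n where mn: "m < length \<sigma>" "\<sigma> ! m = k" "n < length \<sigma>" "\<sigma> ! n = l"
    unfolding is_ranking_def by (metis in_set_conv_nth)
  have "\<not> n < m"
    using assms mn sorted_wrt_nth_less[of "\<lambda>k l. s k \<ge> s l" \<sigma> n m] by (auto simp: is_ranking_def)
  moreover have "m \<noteq> n"
    using mn assms(4) by auto
  ultimately show ?thesis
    using mn unfolding ranked_above_def by (metis linorder_neqE_nat)
qed

text \<open>In a descending list, once one element fails to exceed \<open>t\<close>, all later ones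
  fail too, so the prefix misses nothing.\<close>

lemma set_takeWhile_sorted_desc:
  fixes s :: "'a \<Rightarrow> 'b::linorder"
  assumes "sorted_wrt (\<lambda>k l. s k \<ge> s l) xs"
  shows "set (takeWhile (\<lambda>l. s l > t) xs) = {l \<in> set xs. s l > t}"
  using assms by (induction xs) (auto dest: order.strict_trans2)

lemma increment_empty: "increment W {} b = b"
  by (simp add: increment_def)

text \<open>The side condition keeps layer \<open>l\<close> from being raised twice, as its width in
  \<open>increment W T b\<close> is then still \<open>b l\<close>.\<close>

lemma increment_increment:
  "l \<notin> T \<Longrightarrow> increment W {l} (increment W T b) = increment W (insert l T) b"
  by (auto simp: increment_def)

lemma increment_in_allocations:
  assumes "b \<in> allocations L W" and "T \<subseteq> {1..L}" and "\<And>l. l \<in> T \<Longrightarrow> \<exists>v\<in>W. b l < v"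
  shows "increment W T b \<in> allocations L W"
proof -
  \<comment> \<open>A \<open>LEAST\<close> is known to satisfy its predicate only once a witness
    exists; here that is a wider available width.\<close>
  have "next_width W (b l) \<in> W" if "l \<in> T" for l
    using assms(3)[OF that] LeastI_ex[of "\<lambda>v. v \<in> W \<and> b l < v"]
    unfolding next_width_def by blast
  then show ?thesis
    using assms(1,2) by (auto simp: allocations_def increment_def PiE_iff extensional_def)
qed

lemma bit_cost_increment:
  assumes "T \<subseteq> {1..L}" and "\<And>l. l \<in> T \<Longrightarrow> w l (next_width W (b l)) - w l (b l) = \<delta>"
  shows "bit_cost L w (increment W T b) = bit_cost L w b + real (card T) * \<delta>"
proof -
  have "bit_cost L w (increment W T b) - bit_cost L w b
      = (\<Sum>l=1..L. if l \<in> T then \<delta> else 0)"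
    using assms(2) unfolding bit_cost_def increment_def sum_subtractf[symmetric]
    by (intro sum.cong) auto
  also have "\<dots> = real (card T) * \<delta>"
    using assms(1) by (simp add: sum.If_cases Int_absorb1)
  finally show ?thesis by simp
qed

lemma ranked_allocation_append:
  "ranked_allocation L W w B C b (xs @ ys)
    = ranked_allocation L W w B C (ranked_allocation L W w B C b xs) ys"
  by (simp add: ranked_allocation_def)

text \<open>If the budget pays for the final set of increments, it pays for every intermediate set,
  which is smaller, so no compared layer is refused. The set \<open>T\<close> of layers already
  incremented is general for the sake of the induction.\<close>

lemma ranked_allocation_within_budget:
  assumes "C \<subseteq> {1..L}"
    and "\<And>l. l \<in> C \<Longrightarrow> w l (next_width W (b l)) - w l (b l) = \<delta>"
    and "\<delta> > 0"
    and "distinct xs" and "T \<subseteq> C" and "set xs \<inter> T = {}"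
    and "bit_cost L w b + real (card (T \<union> C \<inter> set xs)) * \<delta> \<le> B"
  shows "ranked_allocation L W w B C (increment W T b) xs = increment W (T \<union> C \<inter> set xs) b"
  using assms(4-7)
proof (induction xs arbitrary: T)
  case Nil
  then show ?case by (simp add: ranked_allocation_def)
next
  case (Cons l xs)
  show ?case
  proof (cases "l \<in> C")
    case True
    have eq: "insert l T \<union> C \<inter> set xs = T \<union> C \<inter> set (l # xs)"
      using True by auto
    have fin: "finite C"
      using assms(1) finite_subset by blast
    have sub: "insert l T \<subseteq> C"
      using True Cons.prems(2) by blast
    have "card (insert l T) \<le> card (T \<union> C \<inter> set (l # xs))"
      using True fin Cons.prems(2) by (intro card_mono) (auto intro: finite_subset)
    then have "real (card (insert l T)) * \<delta> \<le> real (card (T \<union> C \<inter> set (l # xs))) * \<delta>"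
      using assms(3) by simp
    moreover have "bit_cost L w (increment W (insert l T) b)
        = bit_cost L w b + real (card (insert l T)) * \<delta>"
      using sub assms(1,2) by (intro bit_cost_increment) auto
    ultimately have "bit_cost L w (increment W (insert l T) b) \<le> B"
      using Cons.prems(4) by linarith
    moreover have "increment W {l} (increment W T b) = increment W (insert l T) b"
      using Cons.prems(3) by (intro increment_increment) auto
    ultimately have "ranked_allocation L W w B C (increment W T b) (l # xs)
        = ranked_allocation L W w B C (increment W (insert l T) b) xs"
      using True by (simp add: ranked_allocation_def)
    also have "\<dots> = increment W (insert l T \<union> C \<inter> set xs) b"
      using Cons.prems sub eq by (intro Cons.IH) auto
    finally show ?thesis
      using eq by simp
  next
    case False
    then have "ranked_allocation L W w B C (increment W T b) (l # xs)
        = ranked_allocation L W w B C (increment W T b) xs"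
      by (simp add: ranked_allocation_def)
    also have "\<dots> = increment W (T \<union> C \<inter> set xs) b"
      using Cons.prems False by (intro Cons.IH) auto
    finally show ?thesis
      using False by simp
  qed
qed

text \<open>A refusal leaves \<open>a\<close> unchanged, so the hypothesis about \<open>a\<close>
  applies again at the next layer.\<close>

lemma ranked_allocation_exhausted:
  assumes "\<And>l. l \<in> C \<inter> set xs \<Longrightarrow> bit_cost L w (increment W {l} a) > B"
  shows "ranked_allocation L W w B C a xs = a"
  using assms
proof (induction xs)
  case Nil
  then show ?case by (simp add: ranked_allocation_def)
next
  case (Cons l xs)
  then have "\<not> (l \<in> C \<and> bit_cost L w (increment W {l} a) \<le> B)"
    by force
  then have "ranked_allocation L W w B C a (l # xs) = ranked_allocation L W w B C a xs"
    by (auto simp: ranked_allocation_def)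
  with Cons show ?case by simp
qed

text \<open>The ranking is cut where the scores stop exceeding \<open>t\<close>. The compared layers
  before the cut are exactly \<open>M\<close> and use up the budget; after the cut, each further
  increment would exceed it by \<delta>.\<close>

lemma ranked_allocation_threshold:
  fixes S :: "nat \<Rightarrow> real" and C :: "nat set" and t :: real
  defines "M \<equiv> {l \<in> C. S l > t}"
  assumes "is_ranking L S \<sigma>" and "C \<subseteq> {1..L}"
    and "\<And>l. l \<in> C \<Longrightarrow> w l (next_width W (b l)) - w l (b l) = \<delta>"
    and "\<delta> > 0"
  shows "ranked_allocation L W w (bit_cost L w b + real (card M) * \<delta>) C b \<sigma>
    = increment W M b"
proof -
  define xs where "xs = takeWhile (\<lambda>l. S l > t) \<sigma>"
  define ys where "ys = dropWhile (\<lambda>l. S l > t) \<sigma>"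
  define B where "B = bit_cost L w b + real (card M) * \<delta>"
  have \<sigma>: "\<sigma> = xs @ ys"
    by (simp add: xs_def ys_def)
  have rank: "distinct \<sigma>" "set \<sigma> = {1..L}" "sorted_wrt (\<lambda>k l. S k \<ge> S l) \<sigma>"
    using assms(2) by (auto simp: is_ranking_def)
  have set_xs: "set xs = {l \<in> {1..L}. S l > t}"
    using set_takeWhile_sorted_desc[OF rank(3), of t] rank(2) by (simp add: xs_def)
  have M: "C \<inter> set xs = M"
    using set_xs assms(3) by (auto simp: M_def)
  have disj: "set ys \<inter> M = {}"
    using rank(1) M \<sigma> by auto
  \<comment> \<open>The start \<open>b\<close> is written as \<open>increment W {} b\<close> to
    match the induction lemma with \<open>T = {}\<close>.\<close>
  have "ranked_allocation L W w B C (increment W {} b) xs = increment W ({} \<union> C \<inter> set xs) b"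
    using rank(1) M \<sigma> assms(3,4,5)
    by (intro ranked_allocation_within_budget[where \<delta> = \<delta>]) (auto simp: B_def)
  then have first: "ranked_allocation L W w B C b xs = increment W M b"
    using M by (simp add: increment_empty)
  have "ranked_allocation L W w B C (increment W M b) ys = increment W M b"
  proof (rule ranked_allocation_exhausted)
    fix l assume l: "l \<in> C \<inter> set ys"
    then have "l \<notin> M"
      using disj by auto
    moreover have "finite M"
      using assms(3) by (auto simp: M_def intro: finite_subset)
    moreover have "bit_cost L w (increment W (insert l M) b)
        = bit_cost L w b + real (card (insert l M)) * \<delta>"
      using l assms(3,4) by (intro bit_cost_increment) (auto simp: M_def)
    ultimately show "bit_cost L w (increment W {l} (increment W M b)) > B"
      using assms(5) by (simp add: increment_increment B_def algebra_simps)
  qed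
  then show ?thesis
    using first \<sigma> by (simp add: ranked_allocation_append B_def)
qed

text \<open>Both sets extend \<open>M - {i}\<close> by a single layer, so the two objective values
  differ from a common base by \<kappa> times \<open>s i\<close> and \<open>s j\<close>, with the
  same positive \<kappa>.\<close>

lemma exchange_improves:
  assumes "proportional_benefit J \<phi> W C b s"
    and "M \<subseteq> C" and "i \<in> M" and "j \<in> C - M" and "s i < s j"
  shows "J (increment W (insert j (M - {i})) b) \<phi> < J (increment W M b) \<phi>"
proof -
  have "M - {i} \<subseteq> C"
    using assms(2) by auto
  then obtain \<kappa> where "\<kappa> > 0" and \<kappa>: "\<And>l. l \<in> C - (M - {i}) \<Longrightarrow>
      J (increment W (M - {i}) b) \<phi> - J (increment W (insert l (M - {i})) b) \<phi> = \<kappa> * s l"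
    using assms(1) unfolding proportional_benefit_def by meson
  moreover have "i \<in> C - (M - {i})" "j \<in> C - (M - {i})"
    using assms(2-4) by auto
  moreover have "\<kappa> * s i < \<kappa> * s j"
    using \<open>\<kappa> > 0\<close> assms(5) by simp
  moreover have "insert i (M - {i}) = M"
    using assms(3) by auto
  ultimately show ?thesis
    using \<kappa>[of i] \<kappa>[of j] by (smt (verit))
qed

text \<open>The ranking score \<open>S\<close> and the benefit score \<open>s\<close> are unrelated
  except that they order \<open>i\<close> and \<open>j\<close> oppositely. One budget serves all
  rankings by \<open>S\<close>.\<close>

lemma ranked_allocation_suboptimal:
  fixes S s :: "nat \<Rightarrow> real"
  assumes "b \<in> allocations L W" and "C \<subseteq> {1..L}" and "i \<in> C" and "j \<in> C"
    and "\<And>l. l \<in> C \<Longrightarrow> \<exists>v\<in>W. b l < v"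
    and "equal_cost_increments W w C b"
    and "proportional_benefit J \<phi> W C b s"
    and "S i > S j" and "s i < s j"
  shows "\<exists>B. \<forall>\<sigma>. is_ranking L S \<sigma> \<longrightarrow>
    suboptimal J (feasible L W w B) \<phi> (ranked_allocation L W w B C b \<sigma>)"
proof -
  obtain \<delta> where "\<delta> > 0" and \<delta>: "\<And>l. l \<in> C \<Longrightarrow> w l (next_width W (b l)) - w l (b l) = \<delta>"
    using assms(6) unfolding equal_cost_increments_def by blast
  define M where "M = {l \<in> C. S l > S j}"
  define M' where "M' = insert j (M - {i})"
  define B where "B = bit_cost L w b + real (card M) * \<delta>"
  have M: "M \<subseteq> C" "i \<in> M" "j \<in> C - M" and M': "M' \<subseteq> C"
    using assms(3,4,8) by (auto simp: M_def M'_def)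
  have "finite M"
    using M(1) assms(2) by (meson finite_atLeastAtMost finite_subset)
  \<comment> \<open>Removing the simp rule keeps \<open>card (M - {i})\<close> in the form in which
    \<open>card_Suc_Diff1\<close> mentions it.\<close>
  then have "card M' = card M"
    using M card_Suc_Diff1[of M i] by (simp add: M'_def del: card_Diff_singleton)
  \<comment> \<open>With equal cost increments only the number of incremented layers matters, which
    covers \<open>M\<close> and its exchanged variant \<open>M'\<close> at once.\<close>
  moreover have "increment W T b \<in> feasible L W w B" if "T \<subseteq> C" "card T = card M" for T
  proof -
    have "increment W T b \<in> allocations L W"
      using that(1) assms(1,2,5) by (intro increment_in_allocations) auto
    moreover have "bit_cost L w (increment W T b) = bit_cost L w b + real (card T) * \<delta>"
      using that(1) assms(2) \<delta> by (intro bit_cost_increment) auto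
    ultimately show ?thesis
      using that(2) by (simp add: feasible_def B_def)
  qed
  ultimately have "increment W M b \<in> feasible L W w B" "increment W M' b \<in> feasible L W w B"
    using M(1) M' by auto
  moreover have "J (increment W M' b) \<phi> < J (increment W M b) \<phi>"
    using exchange_improves[OF assms(7) M assms(9)] by (simp add: M'_def)
  ultimately have "suboptimal J (feasible L W w B) \<phi> (increment W M b)"
    unfolding suboptimal_def by blast
  moreover have "ranked_allocation L W w B C b \<sigma> = increment W M b" if "is_ranking L S \<sigma>" for \<sigma>
    unfolding B_def M_def using that assms(2) \<delta> \<open>\<delta> > 0\<close>
    by (rule ranked_allocation_threshold)
  ultimately show ?thesis
    by (intro exI[of _ B]) simp
qed

theorem theorem3:
  fixes D :: "('x \<times> 'y) measure"
    and L :: nat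
    and logits :: "nat \<Rightarrow> 'x \<Rightarrow> real ^ 'c::finite"
    and \<phi> S :: "nat \<Rightarrow> real"
    and i j :: nat
  defines "u \<equiv> utilization D L logits \<phi>"
  assumes "early_exit_network D L logits"
    and "exit_policy L \<phi>"
    and "i \<in> {1..L}" and "j \<in> {1..L}"
    and "S i > S j"
    and "u i * S i < u j * S j"
  shows "(\<forall>\<sigma> \<tau>. is_ranking L S \<sigma> \<and> is_ranking L (\<lambda>l. u l * S l) \<tau> \<longrightarrow> inconsistent_rankings \<sigma> \<tau>)
    \<and> (\<forall>(qlogits :: (nat \<Rightarrow> nat) \<Rightarrow> nat \<Rightarrow> 'x \<Rightarrow> real ^ 'c) (loss :: real ^ 'c \<Rightarrow> 'y \<Rightarrow> real)
          (c :: nat \<Rightarrow> nat \<Rightarrow> real) (lam :: real) (W :: nat set) (w :: nat \<Rightarrow> nat \<Rightarrow> real)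
          (C :: nat set) (b :: nat \<Rightarrow> nat).
        (\<forall>a\<in>allocations L W. integrable D (sample_loss L logits qlogits loss a \<phi>))
        \<and> b \<in> allocations L W
        \<and> C \<subseteq> {1..L} \<and> i \<in> C \<and> j \<in> C
        \<and> (\<forall>l\<in>C. \<exists>v\<in>W. b l < v)
        \<and> equal_cost_increments W w C b
        \<and> proportional_benefit (apq_objective D L logits qlogits loss c lam) \<phi> W C b (\<lambda>l. u l * S l)
        \<longrightarrow> (\<exists>B. \<forall>\<sigma>. is_ranking L S \<sigma> \<longrightarrow>
              suboptimal (apq_objective D L logits qlogits loss c lam) (feasible L W w B) \<phi>
                (ranked_allocation L W w B C b \<sigma>)))"
proof (intro conjI allI impI, goal_cases)
  case (1 \<sigma> \<tau>)
  \<comment> \<open>The pair \<open>i\<close>, \<open>j\<close> witnesses the inconsistency: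
    \<open>i\<close> comes first in \<sigma> and \<open>j\<close> comes first in \<tau>.\<close>
  then show ?case
    using assms(4-7) ranked_above_if_greater unfolding inconsistent_rankings_def by blast
next
  case (2 qlogits loss c lam W w C b)
  then show ?case
    by (elim conjE, intro ranked_allocation_suboptimal[OF _ _ _ _ _ _ _ assms(6,7)]) auto
qed

end
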